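(* Let $f:\mathbb{R}^n\to\mathbb{R}$ be continuously differentiable, and let $G=[\,g_1\ \dots\ g_m\,]$, $g_{m+1}$, $S$, $Y$ be the gradients and difference matrices produced by $m$ steps of the gradient method with inverse stepsizes $\alpha_1,\dots,\alpha_m$; let $D=\mathrm{diag}(\alpha_1,\dots,\alpha_m)$. Let $G$ be of full rank and let $G=QR$ be its QR decomposition. Let $$T=[\,R\ \ r\,]\,J\,R^{-1},\qquad r=Q^Tg_{m+1},$$ where $J\in\mathbb{R}^{(m+1)\times m}$ is the lower bidiagonal matrix with $J_{ii}=\alpha_i$, $J_{i+1,i}=-\alpha_i$ for $i=1,\dots,m$, and all other entries zero. Consider the decomposition $T=L+\Lambda+U$, where $L$ is strictly lower triangular, $U$ is strictly upper triangular, and $\Lambda$ is diagonal. If $$\Delta Y=Q\,(U-L^T)\,R\,D^{-1}$$ and $\widetilde Y=Y+\Delta Y$, then $\widetilde Y^TS=(Y+\Delta Y)^TS$ is symmetric, and there exists a symmetric matrix $A_+\in\mathbb{R}^{n\times n}$ such that $\widetilde Y=A_+S$ and $Q^TA_+Q=L+\Lambda+L^T$.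
   Context: The gradient method is $x_{k+1}=x_k-\beta_kg_k$ with $g_k=\nabla f(x_k)$ and stepsizes $\beta_k>0$; the inverse stepsizes are $\alpha_k=\beta_k^{-1}$, $k=1,\dots,m$. The matrices $S=[\,s_1\ \dots\ s_m\,]$ and $Y=[\,y_1\ \dots\ y_m\,]$ in $\mathbb{R}^{n\times m}$ have columns $s_k=x_{k+1}-x_k$ and $y_k=g_{k+1}-g_k$, $k=1,\dots,m$. Thus $S=-GD^{-1}$ and $YD=-[\,G\ \ g_{m+1}\,]J$. The QR decomposition is the reduced one: $n\ge m$, $Q\in\mathbb{R}^{n\times m}$ has orthonormal columns, and $R\in\mathbb{R}^{m\times m}$ is upper triangular (nonsingular since $G$ has full rank). $[\,M\ \ v\,]$ denotes the matrix $M$ with the column $v$ appended. *)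

theory Defs
  imports "HOL-Analysis.Analysis"
begin

text \<open>
  Column indices range over a finite linearly ordered type \<open>'m\<close>; \<open>col_pos\<close> is its order
  isomorphism onto \<open>{1..m}\<close> with \<open>m = CARD('m)\<close>. The index set \<open>{1..m+1}\<close> is \<open>'m + unit\<close>,
  with \<open>Inr ()\<close> as the last index.
\<close>

definition col_pos :: "'m::{finite,linorder} \<Rightarrow> nat"
  where "col_pos k = card {j. j \<le> k}"

definition ext_pos :: "'m::{finite,linorder} + unit \<Rightarrow> nat"
  where "ext_pos a = (case a of Inl k \<Rightarrow> col_pos k | Inr _ \<Rightarrow> CARD('m) + 1)"

lemma col_pos_strict_mono: "strict_mono (col_pos :: 'm::{finite,linorder} \<Rightarrow> nat)"
proof (rule strict_monoI)
  fix i k :: 'm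
  assume "i < k"
  then have "{j. j \<le> i} \<subset> {j. j \<le> k}" by force
  then show "col_pos i < col_pos k"
    unfolding col_pos_def by (intro psubset_card_mono) auto
qed

lemma col_pos_bij: "bij_betw (col_pos :: 'm::{finite,linorder} \<Rightarrow> nat) UNIV {1..CARD('m)}"
proof -
  have inj: "inj (col_pos :: 'm \<Rightarrow> nat)"
    using col_pos_strict_mono by (rule strict_mono_imp_inj_on)
  have "range (col_pos :: 'm \<Rightarrow> nat) \<subseteq> {1..CARD('m)}"
  proof
    fix p assume "p \<in> range (col_pos :: 'm \<Rightarrow> nat)"
    then obtain k :: 'm where p: "p = card {j. j \<le> k}" by (auto simp: col_pos_def)
    have "{j. j \<le> k} \<noteq> {}" by auto
    then have "0 < p" unfolding p by (subst card_gt_0_iff) auto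
    moreover have "p \<le> CARD('m)" unfolding p by (intro card_mono) auto
    ultimately show "p \<in> {1..CARD('m)}" by simp
  qed
  moreover have "card (range (col_pos :: 'm \<Rightarrow> nat)) = CARD('m)"
    using inj by (rule card_image)
  ultimately have "range (col_pos :: 'm \<Rightarrow> nat) = {1..CARD('m)}"
    by (intro card_subset_eq) auto
  with inj show ?thesis by (simp add: bij_betw_def)
qed

lemma ext_pos_bij: "bij_betw (ext_pos :: 'm::{finite,linorder} + unit \<Rightarrow> nat) UNIV {1..CARD('m) + 1}"
proof -
  have inj: "inj (col_pos :: 'm \<Rightarrow> nat)" and rng: "range (col_pos :: 'm \<Rightarrow> nat) = {1..CARD('m)}"
    using col_pos_bij[where 'm = 'm] by (auto simp: bij_betw_def)
  have le: "col_pos k \<le> CARD('m)" for k :: 'm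
    using rng by (metis atLeastAtMost_iff rangeI)
  then have ne: "col_pos k \<noteq> Suc (CARD('m))" for k :: 'm
    by (metis Suc_n_not_le_n)
  have "inj (ext_pos :: 'm + unit \<Rightarrow> nat)"
    using inj ne ne[symmetric] by (auto simp: inj_def ext_pos_def split: sum.splits)
  moreover have "range (ext_pos :: 'm + unit \<Rightarrow> nat) = insert (CARD('m) + 1) (range (col_pos :: 'm \<Rightarrow> nat))"
    by (auto simp: ext_pos_def UNIV_sum image_Un image_image)
  ultimately show ?thesis
    unfolding bij_betw_def rng by auto
qed

text \<open>The matrix with columns \<open>v 1, \<dots>, v m\<close>.\<close>

definition mat_of_cols :: "(nat \<Rightarrow> real^'n) \<Rightarrow> real^'m::{finite,linorder}^'n"
  where "mat_of_cols v = (\<chi> i k. v (col_pos k) $ i)"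

definition diag_of :: "(nat \<Rightarrow> real) \<Rightarrow> real^'m::{finite,linorder}^'m::{finite,linorder}"
  where "diag_of a = (\<chi> i j. if i = j then a (col_pos j) else 0)"

definition append_col :: "real^'m^'k \<Rightarrow> real^'k \<Rightarrow> real^('m + unit)^'k"
  where "append_col M v = (\<chi> i a. case a of Inl j \<Rightarrow> M $ i $ j | Inr _ \<Rightarrow> v $ i)"

definition J_mat :: "(nat \<Rightarrow> real) \<Rightarrow> real^'m::{finite,linorder}^('m::{finite,linorder} + unit)"
  where "J_mat \<alpha> = (\<chi> a j.
    if ext_pos a = col_pos j then \<alpha> (col_pos j)
    else if ext_pos a = col_pos j + 1 then - \<alpha> (col_pos j)
    else 0)"

definition symmetric_mat :: "real^'k^'k \<Rightarrow> bool"
  where "symmetric_mat A \<longleftrightarrow> transpose A = A"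

definition diagonal_mat :: "real^'k^'k \<Rightarrow> bool"
  where "diagonal_mat A \<longleftrightarrow> (\<forall>i j. i \<noteq> j \<longrightarrow> A $ i $ j = 0)"

definition upper_triangular_mat :: "real^'k::{finite,linorder}^'k::{finite,linorder} \<Rightarrow> bool"
  where "upper_triangular_mat A \<longleftrightarrow> (\<forall>i j. j < i \<longrightarrow> A $ i $ j = 0)"

definition strictly_upper_triangular_mat :: "real^'k::{finite,linorder}^'k::{finite,linorder} \<Rightarrow> bool"
  where "strictly_upper_triangular_mat A \<longleftrightarrow> (\<forall>i j. j \<le> i \<longrightarrow> A $ i $ j = 0)"

definition strictly_lower_triangular_mat :: "real^'k::{finite,linorder}^'k::{finite,linorder} \<Rightarrow> bool"
  where "strictly_lower_triangular_mat A \<longleftrightarrow> (\<forall>i j. i \<le> j \<longrightarrow> A $ i $ j = 0)"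

definition reduced_qr :: "real^'m::{finite,linorder}^'n \<Rightarrow> real^'m::{finite,linorder}^'n \<Rightarrow> real^'m::{finite,linorder}^'m::{finite,linorder} \<Rightarrow> bool"
  where "reduced_qr G Q R \<longleftrightarrow> G = Q ** R \<and> transpose Q ** Q = mat 1 \<and> upper_triangular_mat R"

end

theory Submission
  imports Defs
begin

text \<open>
  Write \<open>E = D\<^sup>-\<^sup>1\<close>. The gradient step says \<open>S = - G E = Q B\<close> with \<open>B = - R E\<close>, which is
  invertible because \<open>G\<close> has full rank. The differences of consecutive gradients satisfy
  \<open>Y D = - [G g\<^sub>m\<^sub>+\<^sub>1] J\<close>, and multiplying by \<open>Q\<^sup>T\<close> turns this into
  \<open>Q\<^sup>T Y D = - [R r] J = - T R\<close>, that is \<open>Q\<^sup>T Y = T B\<close>. Any \<open>A\<close> with \<open>Y = A S\<close>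
  would therefore satisfy \<open>Q\<^sup>T A Q = T\<close>, and the obstruction to its symmetry is that \<open>T\<close> need not
  be symmetric.
  The perturbation is \<open>\<Delta>Y = - Q (U - L\<^sup>T) B\<close>; it replaces \<open>U\<close> by \<open>L\<^sup>T\<close> and gives
  \<open>Q\<^sup>T (Y + \<Delta>Y) = M B\<close> with the symmetric matrix \<open>M = L + \<Lambda> + L\<^sup>T\<close>.

  It remains to solve a symmetric secant equation. With \<open>Z = (Y + \<Delta>Y) B\<^sup>-\<^sup>1\<close> it reads \<open>A Q = Z\<close>,
  where \<open>Q\<^sup>T Z = M\<close>. This prescribes \<open>A\<close> on the range of \<open>Q\<close>, and by symmetry the rows of \<open>A\<close>
  against that range; \<open>A = Z Q\<^sup>T + Q Z\<^sup>T - Q M Q\<^sup>T\<close> meets both prescriptions, the last term removing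
  the block that the first two count twice. The symmetry of \<open>(Y + \<Delta>Y)\<^sup>T S = S\<^sup>T A S\<close> follows.
\<close>

section \<open>Matrix algebra\<close>

lemma matrix_mul_minus_left: "(- A) ** B = - (A ** B)"
  for A :: "'a::ring_1^'n^'m"
  by (simp add: matrix_matrix_mult_def vec_eq_iff sum_negf)

lemma matrix_mul_minus_right: "A ** (- B) = - (A ** B)"
  for A :: "'a::ring_1^'n^'m"
  by (simp add: matrix_matrix_mult_def vec_eq_iff sum_negf)

lemma matrix_mul_add_left: "(A + B) ** C = A ** C + B ** C"
  for A :: "'a::semiring_1^'n^'m"
  by (simp add: matrix_matrix_mult_def vec_eq_iff sum.distrib distrib_right)

lemma matrix_mul_diff_left: "(A - B) ** C = A ** C - B ** C"
  for A :: "'a::ring_1^'n^'m"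
  by (simp add: matrix_matrix_mult_def vec_eq_iff sum_subtractf left_diff_distrib)

lemma transpose_add: "transpose (A + B) = transpose A + transpose B"
  by (simp add: transpose_def vec_eq_iff)

lemma transpose_diff: "transpose (A - B) = transpose A - transpose B"
  by (simp add: transpose_def vec_eq_iff)

lemma invertible_matrix_inv:
  assumes "invertible A"
  shows "A ** matrix_inv A = mat 1" "matrix_inv A ** A = mat 1"
  using someI_ex[OF assms[unfolded invertible_def]] by (simp_all add: matrix_inv_def)

lemma symmetric_diagonal_mat:
  assumes "diagonal_mat A"
  shows "transpose A = A"
proof -
  have "A $ j $ i = A $ i $ j" for i j
    using assms unfolding diagonal_mat_def by (cases "i = j") simp_all
  then show ?thesis by (simp add: transpose_def vec_eq_iff)
qed

lemma full_rank_right_factor_invertible: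
  fixes Q :: "real^'m^'n" and R :: "real^'m^'m"
  assumes "rank (Q ** R) = CARD('m)"
  shows "invertible R"
proof -
  obtain C where "C ** (Q ** R) = mat 1"
    using assms by (auto simp: full_rank_injective matrix_left_invertible_injective[symmetric])
  then show ?thesis
    by (auto simp: invertible_left_inverse matrix_mul_assoc)
qed

section \<open>The symmetric secant equation\<close>

text \<open>
  A symmetric solution of \<open>A Q = Z\<close> requires \<open>Q\<^sup>T Z = Q\<^sup>T A Q\<close> to be symmetric; for orthonormal
  columns of \<open>Q\<close> this condition is also sufficient.
\<close>

lemma symmetric_extension_orthonormal:
  fixes Q Z :: "real^'m^'n"
  assumes "transpose Q ** Q = mat 1" and "symmetric_mat (transpose Q ** Z)"
  shows "\<exists>A :: real^'n^'n. symmetric_mat A \<and> A ** Q = Z"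
proof -
  define M where "M = transpose Q ** Z"
  \<comment> \<open>The first term already maps \<open>Q\<close> to \<open>Z\<close>, the second makes the sum symmetric, and the third
    cancels the contribution \<open>Q Z\<^sup>T Q = Q M\<close> of the second.\<close>
  define A where "A = Z ** transpose Q + Q ** transpose Z - Q ** M ** transpose Q"
  have M: "transpose M = M"
    using assms(2) by (simp add: M_def symmetric_mat_def)
  then have ZQ: "transpose Z ** Q = M"
    by (simp add: M_def matrix_transpose_mul)
  have "symmetric_mat A"
    by (simp add: symmetric_mat_def A_def transpose_add transpose_diff matrix_transpose_mul
        M matrix_mul_assoc)
  moreover have "A ** Q = Z"
    by (simp add: A_def matrix_mul_add_left matrix_mul_diff_left
        matrix_mul_assoc[symmetric] assms(1) ZQ)
  ultimately show ?thesis by blast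
qed

text \<open>
  Since \<open>B\<close> is invertible, \<open>W = A (Q B)\<close> is the equation \<open>A Q = W B\<^sup>-\<^sup>1\<close>, whose right-hand side
  is compatible with a symmetric \<open>A\<close> because \<open>Q\<^sup>T W B\<^sup>-\<^sup>1 = M\<close>.
\<close>

lemma symmetric_secant_solution:
  fixes Q W :: "real^'m^'n" and B M :: "real^'m^'m"
  assumes Q: "transpose Q ** Q = mat 1"
    and B: "invertible B"
    and M: "symmetric_mat M"
    and W: "transpose Q ** W = M ** B"
  shows "\<exists>A :: real^'n^'n. symmetric_mat A \<and> W = A ** (Q ** B) \<and> transpose Q ** A ** Q = M"
proof -
  define Z where "Z = W ** matrix_inv B"
  have QZ: "transpose Q ** Z = M"
    by (simp add: Z_def matrix_mul_assoc W)
      (simp add: matrix_mul_assoc[symmetric] invertible_matrix_inv[OF B])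
  have ZB: "Z ** B = W"
    by (simp add: Z_def matrix_mul_assoc[symmetric] invertible_matrix_inv[OF B])
  obtain A :: "real^'n^'n" where A: "symmetric_mat A" "A ** Q = Z"
    using symmetric_extension_orthonormal[OF Q] M QZ by metis
  have "W = A ** (Q ** B)"
    by (simp add: matrix_mul_assoc A ZB)
  moreover have "transpose Q ** A ** Q = M"
    by (simp add: matrix_mul_assoc[symmetric] A QZ)
  ultimately show ?thesis using A(1) by blast
qed

lemma symmetric_mat_congruence:
  fixes A :: "real^'n^'n" and S :: "real^'m^'n"
  assumes "symmetric_mat A"
  shows "symmetric_mat (transpose (A ** S) ** S)"
  using assms by (simp add: symmetric_mat_def matrix_transpose_mul matrix_mul_assoc)

section \<open>Matrices with consecutive vectors as columns\<close>

lemma col_pos_in_range: "col_pos (k :: 'm::{finite,linorder}) \<in> {1..CARD('m)}"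
  using col_pos_bij[where 'm = 'm] by (auto simp: bij_betw_def)

lemma mat_of_cols_diag_of:
  "mat_of_cols v ** diag_of a = mat_of_cols (\<lambda>k. a k *\<^sub>R v k)"
  by (simp add: mat_of_cols_def diag_of_def matrix_matrix_mult_def vec_eq_iff
      if_distrib[of "\<lambda>z. _ * z"] cong: if_cong)

lemma mat_of_cols_cong:
  fixes u v :: "nat \<Rightarrow> real^'n"
  assumes "\<And>k. k \<in> {1..CARD('m)} \<Longrightarrow> u k = v k"
  shows "(mat_of_cols u :: real^'m::{finite,linorder}^'n) = mat_of_cols v"
  by (simp add: mat_of_cols_def vec_eq_iff assms[OF col_pos_in_range])

lemma mat_of_cols_minus: "mat_of_cols (\<lambda>k. - v k) = - mat_of_cols v"
  by (simp add: mat_of_cols_def vec_eq_iff)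

lemma diag_of_mult: "diag_of a ** diag_of b = diag_of (\<lambda>k. a k * b k)"
  by (simp add: diag_of_def matrix_matrix_mult_def vec_eq_iff
      if_distrib[of "\<lambda>z. _ * z"] cong: if_cong)

lemma invertible_diag_of:
  assumes "\<And>k. k \<in> {1..CARD('m)} \<Longrightarrow> a k \<noteq> 0"
  shows "invertible (diag_of a :: real^'m::{finite,linorder}^'m::{finite,linorder})"
proof -
  have "diag_of a ** diag_of (\<lambda>k. inverse (a k)) = (mat 1 :: real^'m::{finite,linorder}^'m::{finite,linorder})"
    unfolding diag_of_mult
    by (simp add: diag_of_def mat_def vec_eq_iff assms[OF col_pos_in_range])
  then show ?thesis
    using invertible_right_inverse by blast
qed

lemma matrix_mul_append_col: "A ** append_col M v = append_col (A ** M) (A *v v)"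
  by (auto simp: append_col_def matrix_matrix_mult_def matrix_vector_mult_def vec_eq_iff
      split: sum.split)

lemma append_col_mat_of_cols:
  "append_col (mat_of_cols v :: real^'m::{finite,linorder}^'n) (v (CARD('m) + 1)) $ i $ a
    = v (ext_pos a) $ i"
  by (simp add: append_col_def mat_of_cols_def ext_pos_def split: sum.split)

text \<open>
  Column \<open>j\<close> of the bidiagonal matrix has the entries \<open>\<alpha>\<^sub>j\<close> and \<open>-\<alpha>\<^sub>j\<close> in rows \<open>j\<close> and \<open>j + 1\<close>,
  so multiplication by it forms scaled differences of consecutive columns.
\<close>

lemma append_col_mult_J_mat:
  fixes v :: "nat \<Rightarrow> real^'n"
  shows "append_col (mat_of_cols v :: real^'m::{finite,linorder}^'n) (v (CARD('m) + 1)) ** J_mat \<alpha>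
    = - (mat_of_cols (\<lambda>k. v (k + 1) - v k) ** diag_of \<alpha>)"
proof -
  have "(\<Sum>a\<in>UNIV. v (ext_pos a) $ i * J_mat \<alpha> $ a $ j)
      = \<alpha> (col_pos j) * (v (col_pos j) $ i - v (col_pos j + 1) $ i)" for i and j :: 'm
  proof -
    let ?p = "col_pos j"
    have p: "?p \<in> {1..CARD('m) + 1}" "?p + 1 \<in> {1..CARD('m) + 1}"
      using col_pos_in_range[of j] by auto
    let ?F = "\<lambda>q. v q $ i * (if q = ?p then \<alpha> ?p else if q = ?p + 1 then - \<alpha> ?p else 0)"
    have "(\<Sum>a\<in>UNIV. v (ext_pos a) $ i * J_mat \<alpha> $ a $ j) = (\<Sum>a\<in>UNIV. ?F (ext_pos (a :: 'm + unit)))"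
      by (simp add: J_mat_def)
    also have "\<dots> = (\<Sum>q\<in>{1..CARD('m) + 1}. ?F q)"
      by (rule sum.reindex_bij_betw[OF ext_pos_bij])
    also have "\<dots> = (\<Sum>q\<in>{?p, ?p + 1}. ?F q)"
      using p by (intro sum.mono_neutral_right) auto
    finally show ?thesis by (simp add: algebra_simps)
  qed
  moreover have "(append_col (mat_of_cols v) (v (CARD('m) + 1)) ** J_mat \<alpha>) $ i $ j
      = (\<Sum>a\<in>UNIV. v (ext_pos a) $ i * J_mat \<alpha> $ a $ j)" for i and j :: 'm
    unfolding matrix_matrix_mult_def by (simp only: vec_lambda_beta append_col_mat_of_cols)
  ultimately show ?thesis
    unfolding mat_of_cols_diag_of by (simp add: vec_eq_iff) (simp add: mat_of_cols_def algebra_simps)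
qed

section \<open>Symmetrization of the gradient differences\<close>

theorem proposition5:
  fixes f :: "real^'n \<Rightarrow> real"
    and grad_f :: "real^'n \<Rightarrow> real^'n"
    and x g :: "nat \<Rightarrow> real^'n"
    and \<alpha> \<beta> :: "nat \<Rightarrow> real"
    and G S Y Q \<Delta>Y :: "real^'m::{finite,linorder}^'n"
    and D R T L \<Lambda> U :: "real^'m::{finite,linorder}^'m::{finite,linorder}"
    and r :: "real^'m::{finite,linorder}"
  assumes "\<And>z. GDERIV f z :> grad_f z"
    and "continuous_on UNIV grad_f"
    and "CARD('m) \<le> CARD('n)"
    and "\<And>k. k \<in> {1..CARD('m)} \<Longrightarrow> \<beta> k > 0"
    and "\<And>k. k \<in> {1..CARD('m)} \<Longrightarrow> \<alpha> k = inverse (\<beta> k)"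
    and "\<And>k. k \<in> {1..CARD('m) + 1} \<Longrightarrow> g k = grad_f (x k)"
    and "\<And>k. k \<in> {1..CARD('m)} \<Longrightarrow> x (k + 1) = x k - \<beta> k *\<^sub>R g k"
    and "G = mat_of_cols g"
    and "S = mat_of_cols (\<lambda>k. x (k + 1) - x k)"
    and "Y = mat_of_cols (\<lambda>k. g (k + 1) - g k)"
    and "D = diag_of \<alpha>"
    and "rank G = CARD('m)"
    and "reduced_qr G Q R"
    and "r = transpose Q *v g (CARD('m) + 1)"
    and "T = append_col R r ** J_mat \<alpha> ** matrix_inv R"
    and "strictly_lower_triangular_mat L"
    and "diagonal_mat \<Lambda>"
    and "strictly_upper_triangular_mat U"
    and "T = L + \<Lambda> + U"
    and "\<Delta>Y = Q ** (U - transpose L) ** R ** matrix_inv D"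
  shows "symmetric_mat (transpose (Y + \<Delta>Y) ** S)
    \<and> (\<exists>A :: real^'n^'n. symmetric_mat A \<and> Y + \<Delta>Y = A ** S
          \<and> transpose Q ** A ** Q = L + \<Lambda> + transpose L)"
proof -
  note alpha = assms(5) and beta = assms(4) and step = assms(7)
    and G = assms(8) and S = assms(9) and Y = assms(10) and D = assms(11)
    and r = assms(14) and T = assms(15) and \<Delta>Y = assms(20)
  have QR: "G = Q ** R" and Q: "transpose Q ** Q = mat 1"
    using assms(13) by (simp_all add: reduced_qr_def)
  have "invertible R"
    using assms(12) QR full_rank_right_factor_invertible by metis
  note Rinv = invertible_matrix_inv[OF this]
  have "invertible D"
    unfolding D
  proof (rule invertible_diag_of)
    fix k assume "k \<in> {1..CARD('m)}"
    with alpha beta show "\<alpha> k \<noteq> 0" by force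
  qed
  define E where "E = matrix_inv D"
  have DE: "D ** E = mat 1" and ED: "E ** D = mat 1"
    using invertible_matrix_inv[OF \<open>invertible D\<close>] by (simp_all add: E_def)
  define B where "B = - (R ** E)"
  define M where "M = L + \<Lambda> + transpose L"
  have "(- (D ** matrix_inv R)) ** B = mat 1"
    by (simp add: B_def matrix_mul_minus_left matrix_mul_minus_right)
      (metis DE Rinv(2) matrix_mul_assoc matrix_mul_lid)
  then have B: "invertible B"
    using invertible_left_inverse by blast

  have "S ** D = mat_of_cols (\<lambda>k. - g k)"
    unfolding S D mat_of_cols_diag_of
  proof (rule mat_of_cols_cong)
    fix k assume k: "k \<in> {1..CARD('m)}"
    then have "\<alpha> k * \<beta> k = 1" using alpha beta by force
    then show "\<alpha> k *\<^sub>R (x (k + 1) - x k) = - g k" using step[OF k] by simp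
  qed
  then have "S ** D = - G" by (simp add: G mat_of_cols_minus)
  then have "S ** D ** E = - G ** E" by simp
  then have SB: "S = Q ** B"
    by (simp add: B_def QR matrix_mul_minus_left matrix_mul_minus_right matrix_mul_assoc[symmetric] DE)

  have "transpose Q ** (append_col G (g (CARD('m) + 1)) ** J_mat \<alpha>) = append_col R r ** J_mat \<alpha>"
    by (simp add: matrix_mul_assoc matrix_mul_append_col r QR Q)
  also have "\<dots> = T ** R"
    by (simp add: T matrix_mul_assoc[symmetric] Rinv)
  finally have "transpose Q ** (Y ** D) = - (T ** R)"
    unfolding G append_col_mult_J_mat
    by (simp add: Y D matrix_mul_minus_right minus_equation_iff)
  then have "transpose Q ** (Y ** D) ** E = - (T ** R) ** E" by simp
  then have QY: "transpose Q ** Y = T ** B"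
    by (simp add: B_def matrix_mul_minus_left matrix_mul_minus_right matrix_mul_assoc[symmetric] DE)

  have "transpose Q ** \<Delta>Y = (U - transpose L) ** (R ** E)"
    by (simp add: \<Delta>Y E_def matrix_mul_assoc Q)
  also have "\<dots> = (transpose L - U) ** B"
    by (simp add: B_def matrix_mul_minus_right matrix_mul_diff_left)
  finally have "transpose Q ** (Y + \<Delta>Y) = (T + (transpose L - U)) ** B"
    by (simp only: matrix_add_ldistrib matrix_mul_add_left QY)
  also have "T + (transpose L - U) = M"
    by (simp add: assms(19) M_def)
  finally have QYB: "transpose Q ** (Y + \<Delta>Y) = M ** B" .

  have "symmetric_mat M"
    by (simp add: symmetric_mat_def M_def transpose_add symmetric_diagonal_mat[OF assms(17)])
  from symmetric_secant_solution[OF Q B this QYB] obtain A :: "real^'n^'n"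
    where A: "symmetric_mat A" "Y + \<Delta>Y = A ** S" "transpose Q ** A ** Q = M"
    unfolding SB by blast
  then show ?thesis
    using symmetric_mat_congruence[OF A(1), of S] unfolding M_def by metis
qed

end
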